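(* Let $\mu$ be an ergodic $\sigma$-invariant Borel probability measure on $\Omega=\{-1,0,+1\}^{\mathbb Z}$ which is symmetric and straightforward. Let $x,y\in X=\{0,1\}^{\mathbb Z}$ be two periodic sceneries that are not equivalent, i.e. $y$ cannot be obtained from $x$ by translation and/or reflection. Let $\lambda$ and $\lambda'$ be the scenery measures generated by $x$ and $y$, respectively, and suppose that the global record measures $\rho=(\mu\times\lambda)\circ\Phi^{-1}$ and $\rho'=(\mu\times\lambda')\circ\Phi^{-1}$ are ergodic with respect to $T$. Then $x$ and $y$ are distinguishable, that is, the record measures $\rho_x$ and $\rho_y$ are mutually singular: $\rho_x\perp\rho_y$.
   Context: Let $J=\{-1,0,+1\}$ be the set of steps, whose elements are also written $\mathtt L=-1$, $\mathtt H=0$, $\mathtt R=+1$ (left, hold, right). Let $\Omega=J^{\mathbb Z}$ with its Borel $\sigma$-algebra and left shift $\sigma$, $(\sigma\omega)_n=\omega_{n+1}$. A generalized random walk with holding is given by an ergodic shift-invariant probability measure $\mu$ on $\Omega$ (holding steps are allowed but $\mu(\omega_0=0)=0$ is not excluded). For a word $u=u_1\dots u_n$ over $J$ put $\mu[u]=\mu(\{\omega\in\Omega:\omega_0\dots\omega_{n-1}=u\})$. The mirror image $\overline u$ of $u$ is the word obtained from $u$ by replacing every $\mathtt R$ by $\mathtt L$ and every $\mathtt L$ by $\mathtt R$ (leaving $\mathtt H$ unchanged). The measure $\mu$ is symmetric if $\mu[u]=\mu[\overline u]$ for every finite word $u$ over $J$. It is straightforward if arbitrarily long words of $\mathtt R$'s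 have positive probability, i.e. $\mu[\mathtt R^N]>0$ for every $N\ge1$, where $\mathtt R^N$ is the word consisting of $N$ letters $\mathtt R$. Let $X=\{0,1\}^{\mathbb Z}$ with its Borel $\sigma$-algebra and left shift $T$, $(Tx)_k=x_{k+1}$. Elements of $X$ are called sceneries. The reflection $\overleftarrow{x}$ of $x$ is given by $\overleftarrow{x}_k=x_{-k}$. Sceneries $x$ and $y$ are equivalent if $y=T^kx$ or $y=T^k\overleftarrow{x}$ for some $k\in\mathbb Z$. A scenery $x$ is periodic if $T^px=x$ for some integer $p\ge1$; the smallest such $p$ is $\mathrm{Per}(x)$. The scenery measure generated by a periodic scenery $x$ is $\frac{1}{\mathrm{Per}(x)}\sum_{k=0}^{\mathrm{Per}(x)-1}\delta_{T^kx}$, where $\delta_z$ denotes the point mass at $z$. For $\omega\in\Omega$ and $x\in X$ define $r_0(\omega,x)=x_0$; for $n\ge1$, $r_n(\omega,x)=(T^{\omega_0+\cdots+\omega_{n-1}}x)_0$; for $n<0$, $r_n(\omega,x)=(T^{-\omega_{-1}-\omega_{-2}-\cdots-\omega_{n}}x)_0$. The global recording map is $\Phi:\Omega\times X\to X$, $\Phi(\omega,x)=(r_n(\omega,x))_{n\in\mathbb Z}$. For fixed $x\in X$ the colour record map is $\varphi_x:\Omega\to X$, $\varphi_x(\omega)=\Phi(\omega,x)$, and the record measure of $x$ is $\rho_x=\mu\circ\varphi_x^{-1}$. The global record measure of a $T$-invariant probability measure $\lambda$ on $X$ is $\rho=(\mu\times\lambda)\circ\Phi^{-1}$; it is $T$-invariant.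 *)

theory Defs
  imports "HOL-Probability.Probability"
begin

definition steps :: "int set" where
  "steps = {-1, 0, 1}"

definition colours :: "nat set" where
  "colours = {0, 1}"

text \<open>The product sigma-algebras are the Borel ones: \<open>sets_Step_space\<close>,
  \<open>sets_Scenery_space\<close>.\<close>

definition Step_space :: "(int \<Rightarrow> int) measure" where
  "Step_space = PiM UNIV (\<lambda>_. count_space steps)"

definition Scenery_space :: "(int \<Rightarrow> nat) measure" where
  "Scenery_space = PiM UNIV (\<lambda>_. count_space colours)"

text \<open>The integer power of the left shift; the left shift itself is \<open>shift_by 1\<close>.\<close>

definition shift_by :: "int \<Rightarrow> (int \<Rightarrow> 'a) \<Rightarrow> int \<Rightarrow> 'a" where
  "shift_by k x = (\<lambda>n. x (n + k))"

abbreviation shift :: "(int \<Rightarrow> 'a) \<Rightarrow> int \<Rightarrow> 'a" where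
  "shift \<equiv> shift_by 1"

definition invariant_prob :: "'a measure \<Rightarrow> ('a \<Rightarrow> 'a) \<Rightarrow> bool" where
  "invariant_prob M S \<longleftrightarrow> prob_space M \<and> S \<in> M \<rightarrow>\<^sub>M M \<and> distr M M S = M"

definition ergodic :: "'a measure \<Rightarrow> ('a \<Rightarrow> 'a) \<Rightarrow> bool" where
  "ergodic M S \<longleftrightarrow> invariant_prob M S \<and>
     (\<forall>A\<in>sets M. S -` A \<inter> space M = A \<longrightarrow> measure M A = 0 \<or> measure M A = 1)"

definition mutually_singular :: "'a measure \<Rightarrow> 'a measure \<Rightarrow> bool" where
  "mutually_singular M N \<longleftrightarrow> sets M = sets N \<and>
     (\<exists>A\<in>sets M. emeasure M A = 0 \<and> emeasure N (space N - A) = 0)"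

definition word_prob :: "(int \<Rightarrow> int) measure \<Rightarrow> int list \<Rightarrow> real" where
  "word_prob \<mu> u = measure \<mu> {\<omega> \<in> space \<mu>. \<forall>i<length u. \<omega> (int i) = u ! i}"

definition mirror :: "int list \<Rightarrow> int list" where
  "mirror u = map uminus u"

definition symmetric :: "(int \<Rightarrow> int) measure \<Rightarrow> bool" where
  "symmetric \<mu> \<longleftrightarrow> (\<forall>u. set u \<subseteq> steps \<longrightarrow> word_prob \<mu> u = word_prob \<mu> (mirror u))"

definition straightforward :: "(int \<Rightarrow> int) measure \<Rightarrow> bool" where
  "straightforward \<mu> \<longleftrightarrow> (\<forall>N\<ge>1. word_prob \<mu> (replicate N 1) > 0)"

definition reflection :: "(int \<Rightarrow> 'a) \<Rightarrow> int \<Rightarrow> 'a" where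
  "reflection x = (\<lambda>k. x (- k))"

definition equivalent :: "(int \<Rightarrow> 'a) \<Rightarrow> (int \<Rightarrow> 'a) \<Rightarrow> bool" where
  "equivalent x y \<longleftrightarrow> (\<exists>k. y = shift_by k x \<or> y = shift_by k (reflection x))"

definition periodic :: "(int \<Rightarrow> 'a) \<Rightarrow> bool" where
  "periodic x \<longleftrightarrow> (\<exists>p::nat. p \<ge> 1 \<and> shift_by (int p) x = x)"

definition Per :: "(int \<Rightarrow> 'a) \<Rightarrow> nat" where
  "Per x = (LEAST p. p \<ge> 1 \<and> shift_by (int p) x = x)"

text \<open>The set function below is countably additive, so \<open>measure_of\<close> does not fall back to the
  zero measure; see \<open>emeasure_scenery_measure\<close>.\<close>

definition scenery_measure :: "(int \<Rightarrow> nat) \<Rightarrow> (int \<Rightarrow> nat) measure" where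
  "scenery_measure x = measure_of (space Scenery_space) (sets Scenery_space)
     (\<lambda>A. (\<Sum>k<Per x. emeasure (return Scenery_space (shift_by (int k) x)) A) / of_nat (Per x))"

text \<open>The position at time \<open>n\<close> of the walk that is at the origin at time \<open>0\<close>; for
  \<open>n < 0\<close> it is minus the sum of the steps at times \<open>n, \<dots>, -1\<close>.\<close>

definition displacement :: "(int \<Rightarrow> int) \<Rightarrow> int \<Rightarrow> int" where
  "displacement \<omega> n = (if n \<ge> 0 then \<Sum>i\<in>{0..<n}. \<omega> i else - (\<Sum>i\<in>{n..<0}. \<omega> i))"

definition global_recording :: "(int \<Rightarrow> int) \<Rightarrow> (int \<Rightarrow> nat) \<Rightarrow> int \<Rightarrow> nat" where
  "global_recording \<omega> x = (\<lambda>n. shift_by (displacement \<omega> n) x 0)"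

definition colour_record :: "(int \<Rightarrow> nat) \<Rightarrow> (int \<Rightarrow> int) \<Rightarrow> int \<Rightarrow> nat" where
  "colour_record x = (\<lambda>\<omega>. global_recording \<omega> x)"

definition record_measure :: "(int \<Rightarrow> int) measure \<Rightarrow> (int \<Rightarrow> nat) \<Rightarrow> (int \<Rightarrow> nat) measure" where
  "record_measure \<mu> x = distr \<mu> Scenery_space (colour_record x)"

definition global_record_measure ::
    "(int \<Rightarrow> int) measure \<Rightarrow> (int \<Rightarrow> nat) measure \<Rightarrow> (int \<Rightarrow> nat) measure" where
  "global_record_measure \<mu> \<Lambda> =
     distr (\<mu> \<Otimes>\<^sub>M \<Lambda>) Scenery_space (\<lambda>(\<omega>, x). global_recording \<omega> x)"

definition distinguishable ::
    "(int \<Rightarrow> int) measure \<Rightarrow> (int \<Rightarrow> nat) \<Rightarrow> (int \<Rightarrow> nat) \<Rightarrow> bool" where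
  "distinguishable \<mu> x y \<longleftrightarrow> mutually_singular (record_measure \<mu> x) (record_measure \<mu> y)"

lemma shift_by_0: "shift_by 0 x = x"
  by (simp add: shift_by_def)

lemma shift_by_add: "shift_by (k + l) x = shift_by k (shift_by l x)"
  by (simp add: shift_by_def add.assoc)

lemma space_Step_space: "space Step_space = {\<omega>. \<forall>n. \<omega> n \<in> steps}"
  by (auto simp: Step_space_def space_PiM PiE_def Pi_def)

lemma space_Scenery_space: "space Scenery_space = {x. \<forall>n. x n \<in> colours}"
  by (auto simp: Scenery_space_def space_PiM PiE_def Pi_def)

instance int :: second_countable_topology
proof
  have "open = generate_topology (range (\<lambda>n::int. {n}))"
  proof (intro ext iffI)
    fix S :: "int set"
    have "generate_topology (range (\<lambda>n::int. {n})) (\<Union>x\<in>S. {x})"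
      by (intro generate_topology_Union) (auto intro: generate_topology.intros)
    then show "generate_topology (range (\<lambda>n::int. {n})) S" by simp
  qed (simp add: discrete_topology_class.open_discrete)
  then show "\<exists>B::int set set. countable B \<and> open = generate_topology B"
    by (intro exI[of _ "range (\<lambda>n::int. {n})"]) auto
qed

lemma sets_PiM_count_space_eq_borel:
  fixes A :: "'a :: {countable, discrete_topology, second_countable_topology} set"
  shows "sets (PiM (UNIV :: 'i :: countable set) (\<lambda>_. count_space A)) =
    sets (restrict_space borel {f. \<forall>n. f n \<in> A})" (is "sets ?P = sets (restrict_space borel ?F)")
proof
  have b: "sets (borel :: ('i \<Rightarrow> 'a) measure) = sets (PiM UNIV (\<lambda>_. borel))"
    by (simp add: sets_PiM_equal_borel)
  have sp: "space ?P = ?F"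
    by (auto simp: space_PiM PiE_def Pi_def)
  have "(\<lambda>f. f) \<in> ?P \<rightarrow>\<^sub>M restrict_space borel ?F"
  proof (rule measurable_restrict_space2)
    show "(\<lambda>f. f) \<in> space ?P \<rightarrow> ?F" by (simp add: sp)
    have "(\<lambda>f. f) \<in> ?P \<rightarrow>\<^sub>M PiM UNIV (\<lambda>_. borel)"
    proof (rule measurable_PiM_single')
      fix i :: 'i
      have "(\<lambda>f. f i) \<in> ?P \<rightarrow>\<^sub>M count_space A"
        by (rule measurable_component_singleton) simp
      moreover have "(\<lambda>a. a) \<in> count_space A \<rightarrow>\<^sub>M borel" by simp
      ultimately show "(\<lambda>f. f i) \<in> ?P \<rightarrow>\<^sub>M borel"
        by (rule measurable_compose)
    qed (simp add: PiE_def)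
    then show "(\<lambda>f. f) \<in> ?P \<rightarrow>\<^sub>M borel"
      using measurable_cong_sets[OF refl b] by blast
  qed
  then show "sets (restrict_space borel ?F) \<subseteq> sets ?P"
    using sets.sets_into_space
    by (fastforce dest: measurable_sets simp: sp space_restrict_space Int_absorb2)
  have "(\<lambda>f. f) \<in> restrict_space borel ?F \<rightarrow>\<^sub>M ?P"
  proof (rule measurable_PiM_single')
    fix i :: 'i
    have c: "(\<lambda>f. f i) \<in> (borel :: ('i \<Rightarrow> 'a) measure) \<rightarrow>\<^sub>M borel"
      using measurable_component_singleton[of i UNIV "\<lambda>_. borel"] measurable_cong_sets[OF b refl]
      by blast
    show "(\<lambda>f. f i) \<in> restrict_space borel ?F \<rightarrow>\<^sub>M count_space A"
    proof (rule measurable_count_space_eq_countable[THEN iffD2], simp_all, intro conjI ballI)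
      fix a assume "a \<in> A"
      have "(\<lambda>f :: 'i \<Rightarrow> 'a. f i) -` {a} \<in> sets borel"
        using measurable_sets[OF c, of "{a}"] by (simp add: borel_open discrete_topology_class.open_discrete)
      then show "(\<lambda>f. f i) -` {a} \<inter> space (restrict_space borel ?F) \<in> sets (restrict_space borel ?F)"
        by (auto simp: sets_restrict_space space_restrict_space)
    qed (auto simp: space_restrict_space)
  qed (auto simp: space_restrict_space PiE_def)
  then show "sets ?P \<subseteq> sets (restrict_space borel ?F)"
    using sets.sets_into_space[of _ ?P]
    by (fastforce dest: measurable_sets simp: sp space_restrict_space Int_absorb2)
qed

lemma sets_Step_space: "sets Step_space = sets (restrict_space borel {\<omega>. \<forall>n. \<omega> n \<in> steps})"
  unfolding Step_space_def by (rule sets_PiM_count_space_eq_borel)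

lemma sets_Scenery_space:
  "sets Scenery_space = sets (restrict_space borel {x. \<forall>n. x n \<in> colours})"
  unfolding Scenery_space_def by (rule sets_PiM_count_space_eq_borel)

lemma shift_by_measurable_Scenery_space: "shift_by k \<in> Scenery_space \<rightarrow>\<^sub>M Scenery_space"
  unfolding Scenery_space_def shift_by_def
  by (rule measurable_PiM_single') (auto simp: space_PiM PiE_def Pi_def)

lemma shift_by_measurable_Step_space: "shift_by k \<in> Step_space \<rightarrow>\<^sub>M Step_space"
  unfolding Step_space_def shift_by_def
  by (rule measurable_PiM_single') (auto simp: space_PiM PiE_def Pi_def)

lemma Per_properties:
  assumes "periodic x"
  shows "Per x \<ge> 1" and "shift_by (int (Per x)) x = x"
  using assms LeastI_ex[of "\<lambda>p. p \<ge> 1 \<and> shift_by (int p) x = x"]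
  unfolding periodic_def Per_def by auto

lemma sets_scenery_measure: "sets (scenery_measure x) = sets Scenery_space"
  by (simp add: scenery_measure_def)

lemma space_scenery_measure: "space (scenery_measure x) = space Scenery_space"
  by (simp add: scenery_measure_def)

lemma emeasure_scenery_measure:
  assumes "A \<in> sets Scenery_space"
  shows "emeasure (scenery_measure x) A =
    (\<Sum>k<Per x. emeasure (return Scenery_space (shift_by (int k) x)) A) / of_nat (Per x)"
proof (rule emeasure_measure_of[OF scenery_measure_def])
  show "countably_additive (sets (scenery_measure x))
    (\<lambda>A. (\<Sum>k<Per x. emeasure (return Scenery_space (shift_by (int k) x)) A) / of_nat (Per x))"
  proof (rule countably_additiveI)
    fix B :: "nat \<Rightarrow> (int \<Rightarrow> nat) set"
    assume B: "range B \<subseteq> sets (scenery_measure x)" "disjoint_family B"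
    have "(\<Sum>i. emeasure (return Scenery_space (shift_by (int k) x)) (B i)) =
        emeasure (return Scenery_space (shift_by (int k) x)) (\<Union>i. B i)" for k
      using B by (intro suminf_emeasure) (auto simp: sets_scenery_measure)
    then show "(\<Sum>i. (\<Sum>k<Per x. emeasure (return Scenery_space (shift_by (int k) x)) (B i)) /
          of_nat (Per x)) =
        (\<Sum>k<Per x. emeasure (return Scenery_space (shift_by (int k) x)) (\<Union>i. B i)) / of_nat (Per x)"
      by (simp add: suminf_sum)
  qed
qed (use assms in \<open>auto simp: positive_def sets_scenery_measure sets.space_closed\<close>)

lemma displacement_measurable: "(\<lambda>\<omega>. displacement \<omega> n) \<in> Step_space \<rightarrow>\<^sub>M count_space UNIV"
proof -
  have comp: "(\<lambda>\<omega>. \<omega> i) \<in> Step_space \<rightarrow>\<^sub>M count_space UNIV" for i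
    unfolding Step_space_def
    by (rule measurable_compose[OF measurable_component_singleton]) auto
  have s: "(\<lambda>\<omega>. \<Sum>i\<in>I. \<omega> i) \<in> Step_space \<rightarrow>\<^sub>M count_space UNIV" if "finite I" for I
    using that
  proof (induction I rule: finite_induct)
    case (insert i I)
    have "(\<lambda>\<omega>. k + sum \<omega> I) \<in> Step_space \<rightarrow>\<^sub>M count_space UNIV" for k
      by (rule measurable_compose[OF insert.IH]) simp
    then have "(\<lambda>\<omega>. \<omega> i + sum \<omega> I) \<in> Step_space \<rightarrow>\<^sub>M count_space UNIV"
      using comp by (rule measurable_compose_countable)
    then show ?case using insert.hyps by simp
  qed simp
  show ?thesis
  proof (cases "n \<ge> 0")
    case True
    then show ?thesis using s[of "{0..<n}"] by (simp add: displacement_def)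
  next
    case False
    have "(\<lambda>\<omega>. - sum \<omega> {n..<0}) \<in> Step_space \<rightarrow>\<^sub>M count_space UNIV"
      by (rule measurable_compose[OF s]) simp_all
    with False show ?thesis by (simp add: displacement_def)
  qed
qed

lemma global_recording_measurable:
  "(\<lambda>(\<omega>, x). global_recording \<omega> x) \<in> Step_space \<Otimes>\<^sub>M Scenery_space \<rightarrow>\<^sub>M Scenery_space"
proof -
  have "(\<lambda>p. snd p (displacement (fst p) n)) \<in>
      Step_space \<Otimes>\<^sub>M Scenery_space \<rightarrow>\<^sub>M count_space colours" for n
  proof (rule measurable_compose_countable[where f = "\<lambda>k p. snd p k"])
    show "(\<lambda>p. displacement (fst p) n) \<in> Step_space \<Otimes>\<^sub>M Scenery_space \<rightarrow>\<^sub>M count_space UNIV"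
      by (rule measurable_compose[OF measurable_fst displacement_measurable])
    show "(\<lambda>p. snd p k) \<in> Step_space \<Otimes>\<^sub>M Scenery_space \<rightarrow>\<^sub>M count_space colours" for k
      unfolding Scenery_space_def
      by (rule measurable_compose[OF measurable_snd measurable_component_singleton]) simp
  qed
  then show ?thesis
    unfolding global_recording_def shift_by_def
    by (subst (2) Scenery_space_def, intro measurable_PiM_single')
      (auto simp: case_prod_beta space_pair_measure space_Scenery_space PiE_def Pi_def)
qed

lemma colour_record_measurable:
  assumes "x \<in> space Scenery_space"
  shows "colour_record x \<in> Step_space \<rightarrow>\<^sub>M Scenery_space"
  using measurable_compose[OF measurable_Pair2'[OF assms] global_recording_measurable]
  by (simp add: colour_record_def)

end

theory Submission
  imports Defs
begin

text \<open>
  Write \<open>\<rho>\<close> for the global record measure of the scenery measure of a periodic scenery \<open>x\<close>.  It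
  is the average of the record measures of the \<open>Per x\<close> translates of \<open>x\<close>, so \<open>\<rho>\<^sub>x \<le> Per x \<cdot> \<rho>\<close>, and
  every null set of \<open>\<rho>\<close> is a null set of the record measure \<open>\<rho>\<^sub>x\<close>.  Two distinct measures that
  are ergodic for the same transformation are mutually singular
  (\<open>ergodic_measures_mutually_singular\<close>).  Everything thus comes down to showing that \<open>\<rho>\<close>
  determines \<open>x\<close> up to translation and reflection.

  To see this, count how often a colour word \<open>w\<close> of length \<open>n + 1\<close> occurs as a window of \<open>x\<close>, read
  forwards or backwards.  These frequencies are recovered from \<open>\<rho>\<close> by induction on \<open>n\<close>
  (\<open>same_windows_if_global_record_measure_eq\<close>).  Indeed \<open>\<rho>[w]\<close> is the sum over all step words \<open>u\<close>
  of length \<open>n\<close> of \<open>\<mu>[u]\<close> times the frequency with which the path of \<open>u\<close> reads \<open>w\<close> in \<open>x\<close>.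
  By symmetry of \<open>\<mu>\<close> the path of \<open>u\<close> may be averaged with its mirror image, and then the frequency
  depends only on windows read in both directions.  If \<open>u\<close> is not one of the two straight words
  \<open>R\<^sup>n\<close> and \<open>L\<^sup>n\<close>, its path visits at most \<open>n\<close> sites, so its term is known from shorter windows.
  What is left is \<open>\<mu>[R\<^sup>n] + \<mu>[L\<^sup>n]\<close>, or just \<open>1\<close> if \<open>n = 0\<close>, times the wanted frequency, and this
  coefficient is positive because \<open>\<mu>\<close> is straightforward.

  Finally, two periodic sceneries with the same window frequencies are equivalent
  (\<open>equivalent_if_same_windows\<close>): a window of \<open>x\<close> as long as a common period occurs in \<open>y\<close>, in one of
  the two directions, and determines \<open>y\<close> up to translation.
\<close>

section \<open>Distinct ergodic measures\<close>

text \<open>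
  The sets on which \<open>\<delta> = M - N\<close> attains its maximum, for example the positive set \<open>Y\<close> of a Hahn
  decomposition, are closed under intersection (\<open>\<delta>\<close> is additive), under monotone limits, and under
  preimages by \<open>S\<close>.  Hence the limit inferior of the sets \<open>S\<^sup>-\<^sup>n Y\<close> is one of them; it is
  strictly invariant, so by ergodicity it has measure \<open>0\<close> or \<open>1\<close> for each of the two measures, and
  not the same value for both, as the maximum of \<open>\<delta>\<close> is positive.  Taking the limit inferior
  makes the set invariant even when \<open>S\<close> has no inverse.
\<close>

lemma ergodic_measures_mutually_singular:
  assumes M: "ergodic M S" and N: "ergodic N S" and sets: "sets M = sets N" and neq: "M \<noteq> N"
  shows "mutually_singular M N"
proof -
  interpret M: prob_space M using M by (simp add: ergodic_def invariant_prob_def)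
  interpret N: prob_space N using N by (simp add: ergodic_def invariant_prob_def)
  have S: "S \<in> M \<rightarrow>\<^sub>M M" and inv_M: "distr M M S = M" and inv_N: "distr N N S = N"
    and S_N: "S \<in> N \<rightarrow>\<^sub>M N"
    using M N by (auto simp: ergodic_def invariant_prob_def)
  have space: "space N = space M"
    using sets by (rule sets_eq_imp_space_eq[symmetric])
  define \<delta> where "\<delta> B = measure M B - measure N B" for B
  obtain Y where Y: "Y \<in> sets M"
    and in_Y: "\<And>X. X \<in> sets M \<Longrightarrow> X \<subseteq> Y \<Longrightarrow> emeasure N X \<le> emeasure M X"
    and off_Y: "\<And>X. X \<in> sets M \<Longrightarrow> X \<inter> Y = {} \<Longrightarrow> emeasure M X \<le> emeasure N X"
    using finite_unsigned_Hahn_decomposition[OF M.finite_measure_axioms N.finite_measure_axioms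
      sets[symmetric]] by auto
  have Un: "\<delta> (A \<union> B) + \<delta> (A \<inter> B) = \<delta> A + \<delta> B" if "A \<in> sets M" "B \<in> sets M" for A B
    using that M.finite_measure_Union'[of A B] N.finite_measure_Union'[of A B]
      M.finite_measure_Diff'[of B A] N.finite_measure_Diff'[of B A]
    by (simp add: \<delta>_def sets Int_commute)
  have split: "\<delta> (A \<inter> B) + \<delta> (A - B) = \<delta> A" if "A \<in> sets M" "B \<in> sets M" for A B
  proof -
    have "(A \<inter> B) \<union> (A - B) = A" "(A \<inter> B) \<inter> (A - B) = {}" by blast+
    then show ?thesis using Un[of "A \<inter> B" "A - B"] that by (simp add: \<delta>_def)
  qed
  have max: "\<delta> B \<le> \<delta> Y" if B: "B \<in> sets M" for B
  proof -
    have "\<delta> (B - Y) \<le> 0" "0 \<le> \<delta> (Y - B)"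
      using off_Y[of "B - Y"] in_Y[of "Y - B"] B Y
      by (auto simp: \<delta>_def M.emeasure_eq_measure N.emeasure_eq_measure)
    moreover have "\<delta> (B \<inter> Y) + \<delta> (B - Y) = \<delta> B" "\<delta> (B \<inter> Y) + \<delta> (Y - B) = \<delta> Y"
      using split[of B Y] split[of Y B] B Y by (simp_all add: Int_commute)
    ultimately show ?thesis by linarith
  qed
  have pos: "\<delta> Y > 0"
  proof (rule ccontr)
    assume "\<not> \<delta> Y > 0"
    with max have nonpos: "\<delta> B \<le> 0" if "B \<in> sets M" for B
      using that by force
    have "\<delta> B = 0" if B: "B \<in> sets M" for B
      using nonpos[OF B] nonpos[OF sets.compl_sets[OF B]] B M.prob_compl[OF B] N.prob_compl[of B]
      by (simp add: \<delta>_def sets space)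
    then have "M = N"
      using sets by (intro measure_eqI)
        (auto simp: \<delta>_def M.emeasure_eq_measure N.emeasure_eq_measure)
    with neq show False ..
  qed
  have \<delta>_vimage: "\<delta> (S -` B \<inter> space M) = \<delta> B" if B: "B \<in> sets M" for B
    using measure_distr[OF S B] measure_distr[OF S_N, of B] B
    by (simp add: \<delta>_def inv_M inv_N sets space)
  have lim_eq: "\<delta> A = \<delta> Y" if "(\<lambda>k. \<delta> (B k)) \<longlonglongrightarrow> \<delta> A" "\<And>k. \<delta> (B k) = \<delta> Y" for A and B :: "nat \<Rightarrow> _"
    using that by (simp add: LIMSEQ_const_iff)
  define Z where "Z n = (S ^^ n) -` Y \<inter> space M" for n
  have S_pow: "S ^^ n \<in> M \<rightarrow>\<^sub>M M" for n
    by (induction n) (use S in \<open>auto intro: measurable_comp simp: id_def\<close>)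
  have Z: "Z n \<in> sets M" for n
    unfolding Z_def by (rule measurable_sets[OF S_pow Y])
  have Z_Suc: "Z (Suc n) = S -` Z n \<inter> space M" for n
    using measurable_space[OF S] by (auto simp: Z_def funpow_swap1)
  have \<delta>_Z: "\<delta> (Z n) = \<delta> Y" for n
  proof (induction n)
    case 0
    show ?case using sets.sets_into_space[OF Y] by (simp add: Z_def Int_absorb2)
  next
    case (Suc n)
    then show ?case by (simp add: Z_Suc \<delta>_vimage Z)
  qed
  define A where "A m = (\<Inter>n\<in>{m..}. Z n)" for m
  have A: "A m \<in> sets M" for m
    unfolding A_def by (rule sets.countable_INT') (use Z in auto)
  have "\<delta> (A m) = \<delta> Y" for m
  proof (rule lim_eq)
    let ?B = "\<lambda>k. \<Inter>n\<in>{m..m + k}. Z n"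
    have B: "?B k \<in> sets M" for k
      by (rule sets.finite_INT) (use Z in auto)
    have INT: "(\<Inter>k. ?B k) = A m"
    proof (intro equalityI subsetI)
      fix z assume z: "z \<in> (\<Inter>k. ?B k)"
      have "z \<in> Z n" if "m \<le> n" for n
        using z that by (auto dest!: spec[of _ "n - m"])
      then show "z \<in> A m" by (simp add: A_def)
    qed (simp add: A_def)
    have dec: "decseq ?B"
      by (auto simp: decseq_def)
    show "(\<lambda>k. \<delta> (?B k)) \<longlonglongrightarrow> \<delta> (A m)"
      unfolding \<delta>_def INT[symmetric] using B sets dec
      by (intro tendsto_diff M.finite_Lim_measure_decseq N.finite_Lim_measure_decseq) auto
    show "\<delta> (?B k) = \<delta> Y" for k
    proof (induction k)
      case 0
      show ?case by (simp add: \<delta>_Z)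
    next
      case (Suc k)
      have "?B (Suc k) = ?B k \<inter> Z (m + Suc k)"
        by (auto simp: le_Suc_eq)
      moreover have "\<delta> (?B k \<union> Z (m + Suc k)) + \<delta> (?B k \<inter> Z (m + Suc k)) = \<delta> Y + \<delta> Y"
        using Un[OF B[of k] Z[of "m + Suc k"]] by (simp only: Suc \<delta>_Z)
      moreover have "\<delta> (?B k \<union> Z (m + Suc k)) \<le> \<delta> Y"
        using B[of k] Z by (intro max sets.Un)
      moreover have "\<delta> (?B k \<inter> Z (m + Suc k)) \<le> \<delta> Y"
        using B[of k] Z by (intro max sets.Int)
      ultimately show ?case by simp
    qed
  qed
  then have \<delta>_liminf: "\<delta> (\<Union>m. A m) = \<delta> Y"
  proof (rule lim_eq[rotated])
    have "incseq A"
      by (auto simp: incseq_def A_def)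
    then show "(\<lambda>m. \<delta> (A m)) \<longlonglongrightarrow> \<delta> (\<Union>m. A m)"
      unfolding \<delta>_def using A sets
      by (intro tendsto_diff M.finite_Lim_measure_incseq N.finite_Lim_measure_incseq) auto
  qed
  have liminf: "(\<Union>m. A m) \<in> sets M"
    using A by auto
  have "S -` (\<Union>m. A m) \<inter> space M = (\<Union>m. A m)"
  proof -
    have "S -` A m \<inter> space M = A (Suc m)" for m
    proof -
      have "S -` A m \<inter> space M = (\<Inter>n\<in>{m..}. S -` Z n \<inter> space M)"
        by (auto simp: A_def)
      also have "\<dots> = (\<Inter>n\<in>Suc ` {m..}. Z n)"
        by (simp add: Z_Suc)
      also have "Suc ` {m..} = {Suc m..}"
        by (auto simp: image_iff Suc_le_eq less_iff_Suc_add)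
      finally show ?thesis by (simp only: A_def)
    qed
    then have "S -` (\<Union>m. A m) \<inter> space M = (\<Union>m. A (Suc m))" by blast
    also have "\<dots> = (\<Union>m. A m)"
      unfolding A_def using Suc_leD by blast
    finally show ?thesis .
  qed
  then have "measure M (\<Union>m. A m) \<in> {0, 1}" "measure N (\<Union>m. A m) \<in> {0, 1}"
    using M N liminf by (auto simp: ergodic_def sets space)
  with \<delta>_liminf pos have "measure M (\<Union>m. A m) = 1" "measure N (\<Union>m. A m) = 0"
    unfolding \<delta>_def by auto
  then have "emeasure M (space M - (\<Union>m. A m)) = 0" "emeasure N (\<Union>m. A m) = 0"
    using M.prob_compl[OF liminf] by (simp_all add: M.emeasure_eq_measure N.emeasure_eq_measure)
  moreover have "space N - (space M - (\<Union>m. A m)) = (\<Union>m. A m)"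
    using sets.sets_into_space[OF liminf] by (simp only: space double_diff order_refl)
  moreover have "space M - (\<Union>m. A m) \<in> sets M"
    using liminf by (rule sets.compl_sets)
  ultimately show ?thesis
    unfolding mutually_singular_def using sets by metis
qed

section \<open>Means over the translates and reflections of a scenery\<close>

text \<open>
  A symmetric walk cannot tell a scenery from its reflection, so only this mean over both
  orientations, and not the mean over translates alone, can be recovered from a record measure.
\<close>

definition dihedral_mean :: "(int \<Rightarrow> 'a) \<Rightarrow> ((int \<Rightarrow> 'a) \<Rightarrow> real) \<Rightarrow> real" where
  "dihedral_mean x f =
     (\<Sum>k<Per x. f (shift_by (int k) x) + f (reflection (shift_by (int k) x))) / real (Per x)"

lemma sum_period_shift:
  fixes h :: "int \<Rightarrow> 'b::comm_monoid_add"
  assumes "\<And>i. h (i + int p) = h i"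
  shows "(\<Sum>k<p. h (int k + a)) = (\<Sum>k<p. h (int k))"
proof -
  have step: "(\<Sum>k<p. h (int k + (a + 1))) = (\<Sum>k<p. h (int k + a))" for a
  proof (cases p)
    case (Suc m)
    have "(\<Sum>k<p. h (int k + (a + 1))) = (\<Sum>k<m. h (int (Suc k) + a)) + h (a + int p)"
      unfolding Suc by (simp add: add_ac)
    also have "\<dots> = h (int 0 + a) + (\<Sum>k<m. h (int (Suc k) + a))"
      using assms by (simp add: add.commute)
    also have "\<dots> = (\<Sum>k<p. h (int k + a))"
      unfolding Suc by (subst sum.lessThan_Suc_shift) simp
    finally show ?thesis .
  qed simp
  show ?thesis
  proof (induction a rule: int_induct[where k = 0])
    case (step2 i)
    then show ?case using step[of "i - 1"] by simp
  qed (simp_all add: step)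
qed

lemma dihedral_mean_shift:
  assumes "periodic x"
  shows "dihedral_mean x (\<lambda>z. f (shift_by a z)) = dihedral_mean x f"
proof -
  have per: "shift_by (k + int (Per x)) x = shift_by k x" for k
    by (simp add: shift_by_add Per_properties(2)[OF assms])
  have "(\<Sum>k<Per x. f (shift_by a (shift_by (int k) x))) = (\<Sum>k<Per x. f (shift_by (int k) x))"
    using sum_period_shift[of "\<lambda>k. f (shift_by k x)" "Per x" a] per
    by (simp add: add.commute flip: shift_by_add)
  moreover have "shift_by a (reflection (shift_by (int k) x)) = reflection (shift_by (int k + - a) x)" for k
    by (simp add: shift_by_def reflection_def algebra_simps)
  then have "(\<Sum>k<Per x. f (shift_by a (reflection (shift_by (int k) x)))) =
      (\<Sum>k<Per x. f (reflection (shift_by (int k) x)))"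
    using sum_period_shift[of "\<lambda>k. f (reflection (shift_by k x))" "Per x" "- a"] per by simp
  ultimately show ?thesis
    by (simp add: dihedral_mean_def sum.distrib)
qed

lemma dihedral_mean_reflection:
  "dihedral_mean x (\<lambda>z. f (reflection z)) = dihedral_mean x f"
  by (simp add: dihedral_mean_def reflection_def add.commute)

lemma dihedral_mean_sum:
  "dihedral_mean x (\<lambda>z. \<Sum>i\<in>I. c i * f i z) = (\<Sum>i\<in>I. c i * dihedral_mean x (f i))"
proof -
  have "dihedral_mean x (\<lambda>z. \<Sum>i\<in>I. c i * f i z) =
      (\<Sum>k<Per x. \<Sum>i\<in>I. c i * (f i (shift_by (int k) x) + f i (reflection (shift_by (int k) x)))) / real (Per x)"
    unfolding dihedral_mean_def by (simp add: sum.distrib distrib_left)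
  also have "\<dots> = (\<Sum>i\<in>I. c i * dihedral_mean x (f i))"
    unfolding dihedral_mean_def
    by (subst sum.swap) (simp add: sum_divide_distrib sum_distrib_left)
  finally show ?thesis .
qed

lemma dihedral_mean_cong:
  assumes "x \<in> space Scenery_space" "\<And>z. z \<in> space Scenery_space \<Longrightarrow> f z = g z"
  shows "dihedral_mean x f = dihedral_mean x g"
  using assms by (simp add: dihedral_mean_def space_Scenery_space shift_by_def reflection_def)

definition same_windows :: "nat \<Rightarrow> (int \<Rightarrow> nat) \<Rightarrow> (int \<Rightarrow> nat) \<Rightarrow> bool" where
  "same_windows m x y \<longleftrightarrow> (\<forall>w. dihedral_mean x (\<lambda>z. of_bool (\<forall>i\<in>{0..int m}. z i = w i)) =
     dihedral_mean y (\<lambda>z. of_bool (\<forall>i\<in>{0..int m}. z i = w i)))"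

text \<open>
  A function of the colours on a finite interval is a linear combination of indicators of windows
  on that interval, and by translation invariance of the mean the interval may start at \<open>0\<close>.
\<close>
lemma same_windows_local:
  assumes "same_windows m x y"
    and x: "x \<in> space Scenery_space" "periodic x" and y: "y \<in> space Scenery_space" "periodic y"
    and local: "\<And>z z'. (\<forall>i\<in>{a..a + int m}. z i = z' i) \<Longrightarrow> f z = f z'"
  shows "dihedral_mean x f = dihedral_mean y f"
proof -
  define g where "g z = f (shift_by (- a) z)" for z
  have g: "g z = g z'" if "\<forall>i\<in>{0..int m}. z i = z' i" for z z'
    unfolding g_def using that by (intro local) (auto simp: shift_by_def)
  define V where "V = (\<Pi>\<^sub>E i\<in>{0..int m}. colours)"
  have fin: "finite V"
    unfolding V_def by (intro finite_PiE) (auto simp: colours_def)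
  have expand: "g z = (\<Sum>v\<in>V. g v * of_bool (\<forall>i\<in>{0..int m}. z i = v i))"
    if z: "z \<in> space Scenery_space" for z
  proof -
    define r where "r = restrict z {0..int m}"
    have r: "r \<in> V" using z by (auto simp: V_def r_def space_Scenery_space)
    have eq: "(\<forall>i\<in>{0..int m}. z i = v i) \<longleftrightarrow> v = r" if "v \<in> V" for v
      using that by (auto simp: V_def r_def PiE_def extensional_def fun_eq_iff)
    have "(\<Sum>v\<in>V. g v * of_bool (\<forall>i\<in>{0..int m}. z i = v i)) = (\<Sum>v\<in>V. if v = r then g v else 0)"
      by (intro sum.cong refl) (simp only: eq, simp)
    also have "\<dots> = g r" using fin r by simp
    also have "\<dots> = g z" by (rule g) (simp add: r_def)
    finally show ?thesis ..
  qed
  have mean: "dihedral_mean z f =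
      (\<Sum>v\<in>V. g v * dihedral_mean z (\<lambda>z. of_bool (\<forall>i\<in>{0..int m}. z i = v i)))"
    if "z \<in> space Scenery_space" "periodic z" for z
  proof -
    have "dihedral_mean z f = dihedral_mean z g"
      unfolding g_def by (rule dihedral_mean_shift[symmetric]) fact
    also have "\<dots> = dihedral_mean z (\<lambda>z. \<Sum>v\<in>V. g v * of_bool (\<forall>i\<in>{0..int m}. z i = v i))"
      using that(1) expand by (rule dihedral_mean_cong)
    finally show ?thesis by (simp only: dihedral_mean_sum)
  qed
  show ?thesis
    using assms(1) by (simp add: mean x y same_windows_def)
qed

section \<open>Paths of step words\<close>

definition words :: "nat \<Rightarrow> int list set" where
  "words n = {u. set u \<subseteq> steps \<and> length u = n}"

definition position :: "int list \<Rightarrow> nat \<Rightarrow> int" where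
  "position u i = sum_list (take i u)"

lemma abs_sum_steps_le:
  assumes "set u \<subseteq> steps"
  shows "\<bar>sum_list u\<bar> \<le> int (length u)"
  using assms by (induction u) (auto simp: steps_def)

lemma sum_steps_eq_length:
  assumes "set u \<subseteq> steps" "sum_list u = int (length u)"
  shows "u = replicate (length u) 1"
  using assms
proof (induction u)
  case (Cons c u)
  then show ?case using abs_sum_steps_le[of u] by (auto simp: steps_def)
qed simp

lemma length_mirror: "length (mirror u) = length u"
  by (simp add: mirror_def)

lemma mirror_words: "u \<in> words n \<Longrightarrow> mirror u \<in> words n"
  by (auto simp: words_def mirror_def steps_def)

lemma mirror_mirror: "mirror (mirror u) = u"
  by (simp add: mirror_def comp_def)

lemma sum_list_mirror: "sum_list (mirror u) = - sum_list u"
  by (induction u) (auto simp: mirror_def)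

lemma position_mirror: "position (mirror u) i = - position u i"
  using sum_list_mirror[of "take i u"] by (simp add: position_def mirror_def take_map)

lemma position_diff_le:
  assumes "u \<in> words n" "i \<le> j" "j \<le> n"
  shows "\<bar>position u j - position u i\<bar> \<le> int (j - i)"
proof -
  have "take j u = take i u @ take (j - i) (drop i u)"
    using take_add[of i "j - i" u] assms by simp
  then have "position u j - position u i = sum_list (take (j - i) (drop i u))"
    by (simp add: position_def)
  moreover have "set (take (j - i) (drop i u)) \<subseteq> steps"
    using assms set_take_subset[of "j - i" "drop i u"] set_drop_subset[of i u]
    unfolding words_def by blast
  ultimately show ?thesis
    using abs_sum_steps_le[of "take (j - i) (drop i u)"] assms by (simp add: words_def)
qed

text \<open>
  Steps have size at most \<open>1\<close>, so a path can visit two sites at distance \<open>n\<close> within \<open>n\<close> steps only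
  as its two end points, and then all its steps are equal.
\<close>
lemma non_straight_path_range:
  assumes u: "u \<in> words n" and "u \<noteq> replicate n 1" "u \<noteq> replicate n (- 1)"
  obtains a where "n > 0" "\<And>i. i \<le> n \<Longrightarrow> position u i \<in> {a..a + int (n - 1)}"
proof
  show "n > 0" using assms by (auto simp: words_def intro!: Nat.gr0I)
  define a where "a = Min (position u ` {..n})"
  fix i assume i: "i \<le> n"
  have "a \<le> position u i" unfolding a_def using i by (intro Min_le) auto
  moreover have "position u i \<le> a + int (n - 1)"
  proof (rule ccontr)
    assume *: "\<not> ?thesis"
    have "a \<in> position u ` {..n}" unfolding a_def by (intro Min_in) auto
    then obtain j where j: "j \<le> n" "a = position u j" by auto
    have far: "position u i - position u j \<ge> int n"
      using * \<open>n > 0\<close> j by linarith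
    have ends: "position u n = int n \<or> position u n = - int n"
    proof (cases "i \<le> j")
      case True
      then have "position u i - position u j \<le> int j - int i"
        using position_diff_le[OF u, of i j] j by simp
      then have "i = 0" "j = n" "position u i - position u j = int n"
        using far j True by linarith+
      then show ?thesis by (simp add: position_def)
    next
      case False
      then have "position u i - position u j \<le> int i - int j"
        using position_diff_le[OF u, of j i] i by simp
      then have "j = 0" "i = n" "position u i - position u j = int n"
        using far i False by linarith+
      then show ?thesis by (simp add: position_def)
    qed
    have n: "position u n = sum_list u" "length u = n" "set u \<subseteq> steps"
      using u by (simp_all add: position_def words_def)
    from ends show False
    proof
      assume "position u n = int n"
      then show False using sum_steps_eq_length[of u] n assms(2) by simp
    next
      assume "position u n = - int n"
      then have "mirror u = replicate n 1"
        using sum_steps_eq_length[of "mirror u"] n mirror_words[OF u]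
        by (simp add: sum_list_mirror length_mirror words_def)
      then have "u = replicate n (- 1)"
        using mirror_mirror[of u] by (simp add: mirror_def)
      with assms(3) show False ..
    qed
  qed
  ultimately show "position u i \<in> {a..a + int (n - 1)}" by simp
qed

section \<open>Periodic sceneries with equal windows\<close>

lemma shift_by_multiple_period:
  assumes "shift_by p x = x"
  shows "shift_by (p * int k) x = x"
  using assms by (induction k) (simp_all add: shift_by_0 distrib_left shift_by_add)

lemma eq_if_eq_on_period:
  assumes "shift_by (int p) x = x" "shift_by (int p) z = z" "p > 0"
    and eq: "\<forall>i\<in>{0..int p}. z i = x i"
  shows "z = x"
proof
  fix i :: int
  have per: "h (i mod int p) = h i" if "shift_by (int p) h = h" for h :: "int \<Rightarrow> 'a"
  proof -
    have "h (j + int p * int k) = h j" for j k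
      using fun_cong[OF shift_by_multiple_period[OF that, of k], of j] by (simp add: shift_by_def)
    note * = this
    show ?thesis
    proof (cases "i div int p \<ge> 0")
      case True
      then show ?thesis using *[of "i mod int p" "nat (i div int p)"] by (simp add: mod_mult_div_eq)
    next
      case False
      then show ?thesis using *[of i "nat (- (i div int p))"]
        by (simp add: minus_mult_div_eq_mod algebra_simps)
    qed
  qed
  show "z i = x i"
    using per[OF assms(1)] per[OF assms(2)] eq assms(3)
    by (metis atLeastAtMost_iff of_nat_0_less_iff order_less_imp_le pos_mod_bound pos_mod_sign)
qed

lemma equivalent_if_same_windows:
  assumes x: "periodic x" and y: "periodic y" and same: "\<And>m. same_windows m x y"
  shows "equivalent x y"
proof -
  define n where "n = Per x * Per y"
  have pos: "Per x > 0" "Per y > 0"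
    using Per_properties(1)[OF x] Per_properties(1)[OF y] by auto
  define f :: "(int \<Rightarrow> nat) \<Rightarrow> real"
    where "f = (\<lambda>z. of_bool (\<forall>i\<in>{0..int n}. z i = x i))"
  have "(\<Sum>k<Per x. f (shift_by (int k) x) + f (reflection (shift_by (int k) x))) > 0"
  proof (rule sum_pos2[where i = 0])
    show "0 < f (shift_by (int 0) x) + f (reflection (shift_by (int 0) x))"
      by (simp add: f_def shift_by_0)
  qed (use pos in \<open>auto simp: f_def\<close>)
  then have "dihedral_mean x f > 0"
    using pos by (simp add: dihedral_mean_def)
  then have "dihedral_mean y f \<noteq> 0"
    using same[of n] unfolding same_windows_def f_def by (metis less_irrefl)
  have "\<exists>k. f (shift_by (int k) y) \<noteq> 0 \<or> f (reflection (shift_by (int k) y)) \<noteq> 0"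
  proof (rule ccontr)
    assume "\<not> ?thesis"
    then have "dihedral_mean y f = 0" by (simp add: dihedral_mean_def)
    with \<open>dihedral_mean y f \<noteq> 0\<close> show False ..
  qed
  then obtain k where k: "f (shift_by (int k) y) \<noteq> 0 \<or> f (reflection (shift_by (int k) y)) \<noteq> 0" ..
  have per_x: "shift_by (int n) x = x"
    using shift_by_multiple_period[OF Per_properties(2)[OF x], of "Per y"] by (simp add: n_def)
  have per_y: "shift_by (int n) y = y"
    using shift_by_multiple_period[OF Per_properties(2)[OF y], of "Per x"]
    by (simp add: n_def mult.commute)
  then have per_y': "shift_by (- int n) y = y"
    using shift_by_add[of "- int n" "int n" y] by (simp add: shift_by_0)
  have commute: "shift_by j (shift_by (int k) y) = shift_by (int k) (shift_by j y)" for j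
    by (simp add: add.commute flip: shift_by_add)
  have "n > 0" using pos by (simp add: n_def)
  from k show ?thesis
  proof
    assume "f (shift_by (int k) y) \<noteq> 0"
    then have "\<forall>i\<in>{0..int n}. shift_by (int k) y i = x i"
      by (simp add: f_def)
    moreover have "shift_by (int n) (shift_by (int k) y) = shift_by (int k) y"
      by (simp only: commute per_y)
    ultimately have "shift_by (int k) y = x"
      using eq_if_eq_on_period[OF per_x _ \<open>n > 0\<close>] by blast
    then have "y = shift_by (- int k) x"
      by (auto simp: shift_by_def)
    then show ?thesis unfolding equivalent_def by blast
  next
    assume "f (reflection (shift_by (int k) y)) \<noteq> 0"
    then have "\<forall>i\<in>{0..int n}. reflection (shift_by (int k) y) i = x i"
      by (simp add: f_def)
    moreover have "shift_by (int n) (reflection (shift_by (int k) y)) =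
        reflection (shift_by (- int n) (shift_by (int k) y))"
      by (simp add: shift_by_def reflection_def algebra_simps)
    then have "shift_by (int n) (reflection (shift_by (int k) y)) = reflection (shift_by (int k) y)"
      by (simp only: commute per_y')
    ultimately have "reflection (shift_by (int k) y) = x"
      using eq_if_eq_on_period[OF per_x _ \<open>n > 0\<close>] by blast
    then have "y = shift_by (- int k) (reflection x)"
      by (auto simp: shift_by_def reflection_def)
    then show ?thesis unfolding equivalent_def by blast
  qed
qed

section \<open>Record measures\<close>

text \<open>
  This form reduces integrals over the scenery measure to finite sums.
\<close>
lemma scenery_measure_eq_distr:
  assumes "x \<in> space Scenery_space" and "periodic x"
  shows "scenery_measure x =
    distr (measure_pmf (pmf_of_set {..<Per x})) Scenery_space (\<lambda>k. shift_by (int k) x)"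
proof (rule measure_eqI)
  show "sets (scenery_measure x) =
      sets (distr (measure_pmf (pmf_of_set {..<Per x})) Scenery_space (\<lambda>k. shift_by (int k) x))"
    by (simp add: sets_scenery_measure)
next
  fix A assume "A \<in> sets (scenery_measure x)"
  then have A: "A \<in> sets Scenery_space" by (simp add: sets_scenery_measure)
  have shift: "shift_by (int k) x \<in> space Scenery_space" for k
    using measurable_space[OF shift_by_measurable_Scenery_space assms(1)] .
  have pos: "{..<Per x} \<noteq> {}"
    using Per_properties(1)[OF assms(2)] by (auto simp: lessThan_empty_iff)
  have "emeasure (distr (measure_pmf (pmf_of_set {..<Per x})) Scenery_space (\<lambda>k. shift_by (int k) x)) A =
      (\<integral>\<^sup>+k. indicator A (shift_by (int k) x) \<partial>measure_pmf (pmf_of_set {..<Per x}))"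
    using A shift by (subst nn_integral_indicator[symmetric], simp, subst nn_integral_distr) auto
  also have "\<dots> = (\<Sum>k<Per x. indicator A (shift_by (int k) x)) / of_nat (Per x)"
    by (subst nn_integral_pmf_of_set[OF pos]) auto
  finally show "emeasure (scenery_measure x) A =
      emeasure (distr (measure_pmf (pmf_of_set {..<Per x})) Scenery_space (\<lambda>k. shift_by (int k) x)) A"
    using A by (simp add: emeasure_scenery_measure)
qed

lemma emeasure_global_record_measure:
  assumes sets_\<mu>: "sets \<mu> = sets Step_space" and "prob_space \<mu>"
    and x: "x \<in> space Scenery_space" "periodic x" and A: "A \<in> sets Scenery_space"
  shows "emeasure (global_record_measure \<mu> (scenery_measure x)) A =
    (\<Sum>k<Per x. emeasure (record_measure \<mu> (shift_by (int k) x)) A) / of_nat (Per x)"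
proof -
  let ?\<Lambda> = "scenery_measure x"
  interpret \<mu>: prob_space \<mu> by fact
  have shift: "shift_by (int k) x \<in> space Scenery_space" for k
    using measurable_space[OF shift_by_measurable_Scenery_space x(1)] .
  interpret \<Lambda>: prob_space ?\<Lambda>
    unfolding scenery_measure_eq_distr[OF x]
    by (rule measure_pmf.prob_space_distr) (use shift in simp)
  interpret P: pair_sigma_finite \<mu> ?\<Lambda> ..
  have pos: "{..<Per x} \<noteq> {}"
    using Per_properties(1)[OF x(2)] by (auto simp: lessThan_empty_iff)
  have "sets (\<mu> \<Otimes>\<^sub>M ?\<Lambda>) = sets (Step_space \<Otimes>\<^sub>M Scenery_space)"
    by (rule sets_pair_measure_cong) (simp_all add: sets_\<mu> sets_scenery_measure)
  then have rec: "(\<lambda>(\<omega>, x). global_recording \<omega> x) \<in> \<mu> \<Otimes>\<^sub>M ?\<Lambda> \<rightarrow>\<^sub>M Scenery_space"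
    using global_recording_measurable measurable_cong_sets by blast
  define B where "B = (\<lambda>(\<omega>, x). global_recording \<omega> x) -` A \<inter> space (\<mu> \<Otimes>\<^sub>M ?\<Lambda>)"
  have B: "B \<in> sets (\<mu> \<Otimes>\<^sub>M ?\<Lambda>)"
    unfolding B_def by (rule measurable_sets[OF rec A])
  have slice: "emeasure \<mu> ((\<lambda>\<omega>. (\<omega>, z)) -` B) = emeasure (record_measure \<mu> z) A"
    if z: "z \<in> space Scenery_space" for z
  proof -
    have "colour_record z \<in> \<mu> \<rightarrow>\<^sub>M Scenery_space"
      using colour_record_measurable[OF z] measurable_cong_sets[OF sets_\<mu> refl] by blast
    then have "emeasure (record_measure \<mu> z) A = emeasure \<mu> (colour_record z -` A \<inter> space \<mu>)"
      unfolding record_measure_def using A by (rule emeasure_distr)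
    also have "colour_record z -` A \<inter> space \<mu> = (\<lambda>\<omega>. (\<omega>, z)) -` B"
      using z by (auto simp: B_def space_pair_measure space_scenery_measure colour_record_def)
    finally show ?thesis ..
  qed
  have meas: "(\<lambda>z. emeasure \<mu> ((\<lambda>\<omega>. (\<omega>, z)) -` B)) \<in> borel_measurable Scenery_space"
    using P.measurable_emeasure_Pair2[OF B] measurable_cong_sets[OF sets_scenery_measure refl]
    by blast
  have "emeasure (global_record_measure \<mu> ?\<Lambda>) A = emeasure (\<mu> \<Otimes>\<^sub>M ?\<Lambda>) B"
    unfolding global_record_measure_def B_def by (rule emeasure_distr[OF rec A])
  also have "\<dots> = (\<integral>\<^sup>+z. emeasure \<mu> ((\<lambda>\<omega>. (\<omega>, z)) -` B) \<partial>?\<Lambda>)"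
    by (rule P.emeasure_pair_measure_alt2[OF B])
  also have "\<dots> = (\<integral>\<^sup>+k. emeasure \<mu> ((\<lambda>\<omega>. (\<omega>, shift_by (int k) x)) -` B)
      \<partial>measure_pmf (pmf_of_set {..<Per x}))"
    unfolding scenery_measure_eq_distr[OF x]
    by (rule nn_integral_distr) (use shift meas in auto)
  also have "\<dots> = (\<Sum>k<Per x. emeasure \<mu> ((\<lambda>\<omega>. (\<omega>, shift_by (int k) x)) -` B)) / of_nat (Per x)"
    by (subst nn_integral_pmf_of_set[OF pos]) auto
  finally show ?thesis by (simp add: slice shift)
qed

lemma prob_space_record_measure:
  assumes "sets \<mu> = sets Step_space" "prob_space \<mu>" "z \<in> space Scenery_space"
  shows "prob_space (record_measure \<mu> z)"
proof -
  have "colour_record z \<in> \<mu> \<rightarrow>\<^sub>M Scenery_space"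
    using colour_record_measurable[OF assms(3)] measurable_cong_sets[OF assms(1) refl] by blast
  then show ?thesis
    unfolding record_measure_def by (rule prob_space.prob_space_distr[OF assms(2)])
qed

lemma measure_global_record_measure:
  assumes "sets \<mu> = sets Step_space" "prob_space \<mu>"
    and x: "x \<in> space Scenery_space" "periodic x" and A: "A \<in> sets Scenery_space"
  shows "measure (global_record_measure \<mu> (scenery_measure x)) A =
    (\<Sum>k<Per x. measure (record_measure \<mu> (shift_by (int k) x)) A) / real (Per x)"
proof -
  have "shift_by (int k) x \<in> space Scenery_space" for k
    using measurable_space[OF shift_by_measurable_Scenery_space x(1)] .
  then have "finite_measure (record_measure \<mu> (shift_by (int k) x))" for k
    using prob_space_record_measure[OF assms(1,2)] by (simp add: prob_space.finite_measure)
  then have "emeasure (record_measure \<mu> (shift_by (int k) x)) A =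
      ennreal (measure (record_measure \<mu> (shift_by (int k) x)) A)" for k
    by (rule finite_measure.emeasure_eq_measure)
  moreover have "Per x > 0"
    using Per_properties(1)[OF x(2)] by simp
  ultimately have "emeasure (global_record_measure \<mu> (scenery_measure x)) A =
      ennreal ((\<Sum>k<Per x. measure (record_measure \<mu> (shift_by (int k) x)) A) / real (Per x))"
    by (simp add: emeasure_global_record_measure[OF assms] divide_ennreal sum_nonneg
        ennreal_of_nat_eq_real_of_nat)
  then show ?thesis
    by (simp add: measure_def sum_nonneg)
qed

lemma finite_words: "finite (words n)"
  unfolding words_def by (rule finite_lists_length_eq) (simp add: steps_def)

lemma displacement_eq_position:
  assumes "\<forall>j<length u. \<omega> (int j) = u ! j" "i \<le> length u"
  shows "displacement \<omega> (int i) = position u i"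
proof -
  have "displacement \<omega> (int i) = (\<Sum>j\<in>{0..<i}. \<omega> (int j))"
    unfolding displacement_def
    by (simp, rule sum.reindex_bij_witness[where i = int and j = nat]) auto
  also have "\<dots> = position u i"
    using assms by (auto simp: position_def sum_list_sum_nth min_def intro!: sum.cong)
  finally show ?thesis .
qed

lemma measurable_step [measurable]: "(\<lambda>\<omega>. \<omega> i) \<in> Step_space \<rightarrow>\<^sub>M count_space UNIV"
  unfolding Step_space_def by (rule measurable_compose[OF measurable_component_singleton]) auto

lemma measurable_colour [measurable]: "(\<lambda>r. r i) \<in> Scenery_space \<rightarrow>\<^sub>M count_space UNIV"
  unfolding Scenery_space_def by (rule measurable_compose[OF measurable_component_singleton]) auto

lemma cylinder_in_sets:
  "{r \<in> space Scenery_space. \<forall>i\<le>n. r (int i) = w i} \<in> sets Scenery_space"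
  by measurable

text \<open>
  The first \<open>n + 1\<close> colours of a record are determined by the first \<open>n\<close> steps of the walk.
\<close>
lemma measure_record_cylinder:
  assumes sets_\<mu>: "sets \<mu> = sets Step_space" and "prob_space \<mu>" and z: "z \<in> space Scenery_space"
  shows "measure (record_measure \<mu> z) {r \<in> space Scenery_space. \<forall>i\<le>n. r (int i) = w i} =
    (\<Sum>u\<in>words n. word_prob \<mu> u * of_bool (\<forall>i\<le>n. z (position u i) = w i))"
proof -
  interpret prob_space \<mu> by fact
  let ?C = "{r \<in> space Scenery_space. \<forall>i\<le>n. r (int i) = w i}"
  define E where "E u = {\<omega> \<in> space \<mu>. \<forall>i<length u. \<omega> (int i) = u ! i}" for u :: "int list"
  define U where "U = {u \<in> words n. \<forall>i\<le>n. z (position u i) = w i}"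
  have space_\<mu>: "space \<mu> = space Step_space"
    using sets_\<mu> by (rule sets_eq_imp_space_eq)
  have E: "E u \<in> sets \<mu>" for u
  proof -
    have "{\<omega> \<in> space Step_space. \<forall>i<length u. \<omega> (int i) = u ! i} \<in> sets Step_space"
      by measurable
    then show ?thesis by (simp add: E_def sets_\<mu> space_\<mu>)
  qed
  have rec: "colour_record z \<in> \<mu> \<rightarrow>\<^sub>M Scenery_space"
    using colour_record_measurable[OF z] measurable_cong_sets[OF sets_\<mu> refl] by blast
  have "colour_record z -` ?C \<inter> space \<mu> = (\<Union>u\<in>U. E u)"
  proof (intro equalityI subsetI)
    fix \<omega> assume \<omega>: "\<omega> \<in> colour_record z -` ?C \<inter> space \<mu>"
    define u where "u = map (\<lambda>i. \<omega> (int i)) [0..<n]"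
    have "u \<in> words n"
      using \<omega> by (auto simp: u_def words_def space_\<mu> space_Step_space)
    moreover have "displacement \<omega> (int i) = position u i" if "i \<le> n" for i
      using that by (intro displacement_eq_position) (auto simp: u_def)
    moreover have "\<omega> \<in> E u"
      using \<omega> by (auto simp: E_def u_def)
    ultimately have "u \<in> U"
      using \<omega> by (auto simp: U_def colour_record_def global_recording_def shift_by_def)
    with \<open>\<omega> \<in> E u\<close> show "\<omega> \<in> (\<Union>u\<in>U. E u)" by blast
  next
    fix \<omega> assume "\<omega> \<in> (\<Union>u\<in>U. E u)"
    then obtain u where u: "u \<in> U" "\<omega> \<in> E u" by blast
    have "displacement \<omega> (int i) = position u i" if "i \<le> n" for i
      using that u by (intro displacement_eq_position) (auto simp: U_def E_def words_def)
    moreover have "colour_record z \<omega> \<in> space Scenery_space"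
      using measurable_space[OF rec] u by (simp add: E_def)
    ultimately show "\<omega> \<in> colour_record z -` ?C \<inter> space \<mu>"
      using u by (auto simp: U_def E_def colour_record_def global_recording_def shift_by_def)
  qed
  then have "measure (record_measure \<mu> z) ?C = prob (\<Union>u\<in>U. E u)"
    unfolding record_measure_def by (simp add: measure_distr[OF rec] cylinder_in_sets)
  also have "\<dots> = (\<Sum>u\<in>U. prob (E u))"
  proof (rule finite_measure_finite_Union)
    show "finite U" using finite_words by (simp add: U_def)
    show "E ` U \<subseteq> sets \<mu>" using E by blast
    show "disjoint_family_on E U"
      by (auto simp: disjoint_family_on_def U_def words_def E_def list_eq_iff_nth_eq)
  qed
  also have "\<dots> = (\<Sum>u\<in>words n. word_prob \<mu> u * of_bool (\<forall>i\<le>n. z (position u i) = w i))"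
    using finite_words[of n]
    by (simp add: U_def E_def word_prob_def of_bool_def if_distrib[of "\<lambda>c. _ * c"] sum.If_cases Int_def
        cong: if_cong)
  finally show ?thesis .
qed

lemma sum_words_mirror:
  "(\<Sum>u\<in>words n. f (mirror u)) = (\<Sum>u\<in>words n. f u)"
  by (rule sum.reindex_bij_witness[where i = mirror and j = mirror])
    (simp_all add: mirror_mirror mirror_words)

text \<open>
  Symmetry of \<open>\<mu>\<close> gives a step word and its mirror image the same weight, and the mirror image reads
  in \<open>z\<close> what the word itself reads in the reflection of \<open>z\<close>.  The factor \<open>2\<close> is there because
  \<open>dihedral_mean\<close> sums over both orientations but divides by \<open>Per x\<close>.
\<close>
lemma global_record_cylinder:
  assumes sets_\<mu>: "sets \<mu> = sets Step_space" and \<mu>: "prob_space \<mu>" and sym: "symmetric \<mu>"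
    and x: "x \<in> space Scenery_space" "periodic x"
  shows "2 * measure (global_record_measure \<mu> (scenery_measure x))
      {r \<in> space Scenery_space. \<forall>i\<le>n. r (int i) = w i} =
    (\<Sum>u\<in>words n. word_prob \<mu> u *
      dihedral_mean x (\<lambda>z. of_bool (\<forall>i\<le>n. z (position u i) = w i)))"
proof -
  let ?C = "{r \<in> space Scenery_space. \<forall>i\<le>n. r (int i) = w i}"
  define G where "G z = (\<Sum>u\<in>words n. word_prob \<mu> u * of_bool (\<forall>i\<le>n. z (position u i) = w i))" for z
  have shift: "shift_by (int k) x \<in> space Scenery_space" for k
    using measurable_space[OF shift_by_measurable_Scenery_space x(1)] .
  have refl: "G (reflection z) = G z" for z
  proof -
    have "G (reflection z) =
        (\<Sum>u\<in>words n. word_prob \<mu> (mirror u) * of_bool (\<forall>i\<le>n. z (position (mirror u) i) = w i))"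
      using sym
      by (auto simp: G_def position_mirror reflection_def symmetric_def words_def intro!: sum.cong)
    also have "\<dots> = G z"
      unfolding G_def by (rule sum_words_mirror)
    finally show ?thesis .
  qed
  have "2 * measure (global_record_measure \<mu> (scenery_measure x)) ?C = dihedral_mean x G"
    by (simp add: measure_global_record_measure[OF sets_\<mu> \<mu> x cylinder_in_sets] refl
        measure_record_cylinder[OF sets_\<mu> \<mu> shift] dihedral_mean_def sum_distrib_left flip: G_def)
  then show ?thesis
    by (simp only: G_def[abs_def] dihedral_mean_sum)
qed

section \<open>Recovering the scenery\<close>

lemma position_replicate: "i \<le> n \<Longrightarrow> position (replicate n c) i = int i * c"
  by (simp add: position_def sum_list_replicate)

text \<open>
  The system of equations that expresses the cylinder probabilities of the record through the window
  frequencies is triangular: at length \<open>n\<close> only the two straight words involve windows that are not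
  already known, and by reflection invariance both involve the same one.
\<close>
lemma same_windows_if_global_record_measure_eq:
  assumes sets_\<mu>: "sets \<mu> = sets Step_space" and \<mu>: "prob_space \<mu>"
    and sym: "symmetric \<mu>" and straight: "straightforward \<mu>"
    and x: "x \<in> space Scenery_space" "periodic x" and y: "y \<in> space Scenery_space" "periodic y"
    and eq: "global_record_measure \<mu> (scenery_measure x) = global_record_measure \<mu> (scenery_measure y)"
  shows "same_windows n x y"
proof (induction n rule: less_induct)
  case (less n)
  interpret prob_space \<mu> by fact
  show ?case
    unfolding same_windows_def
  proof
    fix w :: "int \<Rightarrow> nat"
    define f where "f u z = (of_bool (\<forall>i\<le>n. z (position u i) = w (int i)) :: real)"
      for u and z :: "int \<Rightarrow> nat"
    define d where "d u = dihedral_mean x (f u) - dihedral_mean y (f u)" for u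
    let ?R = "replicate n 1 :: int list" and ?L = "replicate n (- 1) :: int list"
    have "(\<Sum>u\<in>words n. word_prob \<mu> u * dihedral_mean x (f u)) =
        (\<Sum>u\<in>words n. word_prob \<mu> u * dihedral_mean y (f u))"
      using global_record_cylinder[OF sets_\<mu> \<mu> sym x, of n "\<lambda>i. w (int i)"]
        global_record_cylinder[OF sets_\<mu> \<mu> sym y, of n "\<lambda>i. w (int i)"] eq
      by (simp add: f_def[abs_def])
    then have "(\<Sum>u\<in>words n. word_prob \<mu> u * d u) = 0"
      by (simp add: d_def right_diff_distrib sum_subtractf)
    moreover have "d u = 0" if u: "u \<in> words n" "u \<noteq> ?R" "u \<noteq> ?L" for u
    proof -
      obtain a where "n > 0" and a: "\<And>i. i \<le> n \<Longrightarrow> position u i \<in> {a..a + int (n - 1)}"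
        using non_straight_path_range[OF u] by blast
      have "dihedral_mean x (f u) = dihedral_mean y (f u)"
      proof (rule same_windows_local[OF _ x y])
        show "same_windows (n - 1) x y" using less \<open>n > 0\<close> by simp
        show "f u z = f u z'" if "\<forall>i\<in>{a..a + int (n - 1)}. z i = z' i" for z z'
          using a that by (simp add: f_def)
      qed
      then show ?thesis by (simp add: d_def)
    qed
    moreover have "{?R, ?L} \<subseteq> words n"
      by (auto simp: words_def steps_def)
    ultimately have "(\<Sum>u\<in>{?R, ?L}. word_prob \<mu> u * d u) = 0"
      using finite_words[of n] by (subst sum.mono_neutral_left[of "words n"]) auto
    moreover have "d ?L = d ?R"
    proof -
      have "f ?L = (\<lambda>z. f ?R (reflection z))"
        by (auto simp: f_def reflection_def position_replicate fun_eq_iff)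
      then show ?thesis by (simp add: d_def dihedral_mean_reflection)
    qed
    then have "(\<Sum>u\<in>{?R, ?L}. word_prob \<mu> u * d u) = (\<Sum>u\<in>{?R, ?L}. word_prob \<mu> u) * d ?R"
      unfolding sum_distrib_right by (intro sum.cong) auto
    moreover have "(\<Sum>u\<in>{?R, ?L}. word_prob \<mu> u) > 0"
    proof (rule sum_pos2[where i = ?R])
      \<comment> \<open>For \<open>n = 0\<close> the two straight words coincide with the empty word, of probability \<open>1\<close>.\<close>
      show "word_prob \<mu> ?R > 0"
        using straight by (cases "n = 0") (auto simp: straightforward_def word_prob_def prob_space)
    qed (auto simp: word_prob_def)
    ultimately have "d ?R = 0" by simp
    moreover have "f ?R = (\<lambda>z. of_bool (\<forall>i\<in>{0..int n}. z i = w i))"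
    proof
      fix z :: "int \<Rightarrow> nat"
      have "(\<forall>i\<le>n. z (int i) = w (int i)) \<longleftrightarrow> (\<forall>i\<in>{0..int n}. z i = w i)"
        by (metis atLeastAtMost_iff int_nat_eq nat_le_iff of_nat_0_le_iff of_nat_le_iff)
      then show "f ?R z = of_bool (\<forall>i\<in>{0..int n}. z i = w i)"
        by (simp add: f_def position_replicate)
    qed
    ultimately show "dihedral_mean x (\<lambda>z. of_bool (\<forall>i\<in>{0..int n}. z i = w i)) =
        dihedral_mean y (\<lambda>z. of_bool (\<forall>i\<in>{0..int n}. z i = w i))"
      by (simp add: d_def)
  qed
qed

text \<open>
  The scenery \<open>x\<close> itself is one of the translates over which the global record measure averages.
\<close>
lemma record_measure_null_if_global_null:
  assumes "sets \<mu> = sets Step_space" "prob_space \<mu>"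
    and x: "x \<in> space Scenery_space" "periodic x" and A: "A \<in> sets Scenery_space"
    and null: "emeasure (global_record_measure \<mu> (scenery_measure x)) A = 0"
  shows "emeasure (record_measure \<mu> x) A = 0"
proof -
  have "Per x > 0" using Per_properties(1)[OF x(2)] by simp
  moreover have "(\<Sum>k<Per x. emeasure (record_measure \<mu> (shift_by (int k) x)) A) = 0"
    using null unfolding emeasure_global_record_measure[OF assms(1-5)]
    by (simp add: ennreal_divide_eq_0_iff)
  ultimately show ?thesis by (force simp: shift_by_0)
qed

theorem theorem4:
  fixes \<mu> :: "(int \<Rightarrow> int) measure" and x y :: "int \<Rightarrow> nat"
  assumes "sets \<mu> = sets Step_space"
    and "ergodic \<mu> shift"
    and "symmetric \<mu>"
    and "straightforward \<mu>"
    and "x \<in> space Scenery_space" and "y \<in> space Scenery_space"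
    and "periodic x" and "periodic y"
    and "\<not> equivalent x y"
    and "ergodic (global_record_measure \<mu> (scenery_measure x)) shift"
    and "ergodic (global_record_measure \<mu> (scenery_measure y)) shift"
  shows "distinguishable \<mu> x y"
proof -
  let ?\<rho> = "\<lambda>x. global_record_measure \<mu> (scenery_measure x)"
  have \<mu>: "prob_space \<mu>"
    using assms(2) by (simp add: ergodic_def invariant_prob_def)
  have "?\<rho> x \<noteq> ?\<rho> y"
    using same_windows_if_global_record_measure_eq[OF assms(1) \<mu> assms(3,4,5,7,6,8)]
      equivalent_if_same_windows[OF assms(7,8)] assms(9) by blast
  then have "mutually_singular (?\<rho> x) (?\<rho> y)"
    using assms(10,11)
    by (intro ergodic_measures_mutually_singular) (simp_all add: global_record_measure_def)
  then obtain A where A: "A \<in> sets Scenery_space"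
    and null: "emeasure (?\<rho> x) A = 0" "emeasure (?\<rho> y) (space Scenery_space - A) = 0"
    by (auto simp: mutually_singular_def global_record_measure_def)
  have "emeasure (record_measure \<mu> x) A = 0"
    by (rule record_measure_null_if_global_null[OF assms(1) \<mu> assms(5,7) A null(1)])
  moreover have "emeasure (record_measure \<mu> y) (space Scenery_space - A) = 0"
    by (rule record_measure_null_if_global_null[OF assms(1) \<mu> assms(6,8) sets.compl_sets[OF A] null(2)])
  ultimately show ?thesis
    using A by (auto simp: distinguishable_def mutually_singular_def record_measure_def)
qed

end
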